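(* Let $k$ be a countable algebraically closed field of characteristic $0$. Then the family of $\le_p$-maximal subsets of $k$ is a comeagre subset of $\mathcal P(k)$.
   Context: For $A,B\subseteq k$, $A\le_p B$ means that there is a polynomial $P\in k[X]$ with $A=P^{-1}(B)$. This is a preorder on the powerset $\mathcal P(k)$; a set $A\subseteq k$ is $\le_p$-maximal if for every $B\subseteq k$, $A\le_p B$ implies $B\le_p A$. $\mathcal P(k)$ is endowed with the topology whose basis is given by the sets $\{A\in\mathcal P(k)\mid u_1,\ldots,u_n\in A,\ v_1,\ldots,v_m\notin A\}$, for any choice of distinct $u_1,\ldots,u_n,v_1,\ldots,v_m\in k$ (when $k$ is countable this is homeomorphic to the Cantor space). *)

theory Defs
  imports "HOL-Analysis.Analysis" "HOL-Computational_Algebra.Polynomial"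
begin

definition poly_reducible :: "'a::field set \<Rightarrow> 'a set \<Rightarrow> bool"  (infix \<open>\<le>\<^sub>p\<close> 50)
  where "A \<le>\<^sub>p B \<longleftrightarrow> (\<exists>P :: 'a poly. A = poly P -` B)"

lemma poly_reducible_refl: "A \<le>\<^sub>p A"
proof -
  have "A = poly [:0, 1:] -` A" by auto
  then show ?thesis unfolding poly_reducible_def by blast
qed

lemma poly_reducible_trans:
  assumes "A \<le>\<^sub>p B" and "B \<le>\<^sub>p C"
  shows "A \<le>\<^sub>p C"
proof -
  obtain P Q where "A = poly P -` B" "B = poly Q -` C"
    using assms unfolding poly_reducible_def by blast
  then have "A = poly (pcompose Q P) -` C" by (auto simp: poly_pcompose)
  then show ?thesis unfolding poly_reducible_def by blast
qed

definition poly_maximal :: "'a::field set \<Rightarrow> bool"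
  where "poly_maximal A \<longleftrightarrow> (\<forall>B. A \<le>\<^sub>p B \<longrightarrow> B \<le>\<^sub>p A)"

definition powerset_basis :: "'a set set set"
  where "powerset_basis =
    {{A. U \<subseteq> A \<and> V \<inter> A = {}} | U V. finite U \<and> finite V \<and> U \<inter> V = {}}"

definition powerset_topology :: "'a set topology"
  where "powerset_topology = topology_generated_by powerset_basis"

text \<open>The generating family is a genuine basis, not merely a subbasis.\<close>

lemma openin_powerset_topology:
  "openin powerset_topology W \<longleftrightarrow> (\<exists>\<B>. \<B> \<subseteq> powerset_basis \<and> W = \<Union>\<B>)"
proof
  have int: "b \<inter> c = {} \<or> b \<inter> c \<in> powerset_basis"
    if "b \<in> powerset_basis" "c \<in> powerset_basis" for b c :: "'a set set"
  proof -
    obtain U V U' V' where *: "finite U" "finite V" "finite U'" "finite V'"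
      and b: "b = {A. U \<subseteq> A \<and> V \<inter> A = {}}" and c: "c = {A. U' \<subseteq> A \<and> V' \<inter> A = {}}"
      using \<open>b \<in> powerset_basis\<close> \<open>c \<in> powerset_basis\<close> unfolding powerset_basis_def by blast
    have eq: "b \<inter> c = {A. U \<union> U' \<subseteq> A \<and> (V \<union> V') \<inter> A = {}}"
      unfolding b c by auto
    show ?thesis
    proof (cases "(U \<union> U') \<inter> (V \<union> V') = {}")
      case True
      with * have "b \<inter> c \<in> powerset_basis"
        unfolding eq powerset_basis_def
        by (intro CollectI exI[of _ "U \<union> U'"] exI[of _ "V \<union> V'"]) simp
      then show ?thesis ..
    next
      case False
      then have "b \<inter> c = {}" unfolding eq by blast
      then show ?thesis ..
    qed
  qed
  assume "openin powerset_topology W"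
  then have "generate_topology_on powerset_basis W"
    unfolding powerset_topology_def openin_topology_generated_by_iff .
  then show "\<exists>\<B>. \<B> \<subseteq> powerset_basis \<and> W = \<Union>\<B>"
  proof induction
    case Empty
    show ?case by (intro exI[of _ "{}"]) auto
  next
    case (Int a b)
    then obtain \<A> \<B> where A: "\<A> \<subseteq> powerset_basis" "a = \<Union>\<A>"
      and B: "\<B> \<subseteq> powerset_basis" "b = \<Union>\<B>" by blast
    let ?\<C> = "{x \<inter> y | x y. x \<in> \<A> \<and> y \<in> \<B> \<and> x \<inter> y \<noteq> {}}"
    have "?\<C> \<subseteq> powerset_basis" using A(1) B(1) int by blast
    moreover have "a \<inter> b = \<Union>?\<C>" unfolding A(2) B(2) by blast
    ultimately show ?case by (intro exI[of _ ?\<C>] conjI)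
  next
    case (UN K)
    let ?\<C> = "{x \<in> powerset_basis. \<exists>k\<in>K. x \<subseteq> k}"
    have "\<Union>K \<subseteq> \<Union>?\<C>"
    proof
      fix x assume "x \<in> \<Union>K"
      then obtain k where k: "k \<in> K" "x \<in> k" by (rule UnionE)
      obtain \<B> where "\<B> \<subseteq> powerset_basis" "k = \<Union>\<B>" using UN.IH[OF k(1)] by (elim exE conjE)
      then obtain y where "y \<in> powerset_basis" "y \<subseteq> k" "x \<in> y" using k(2) by auto
      then have "y \<in> ?\<C>" using k(1) by (intro CollectI conjI bexI[of _ k])
      then show "x \<in> \<Union>?\<C>" using \<open>x \<in> y\<close> by (rule UnionI)
    qed
    moreover have "\<Union>?\<C> \<subseteq> \<Union>K" by (rule Union_least) auto
    ultimately have "\<Union>K = \<Union>?\<C>" by (rule equalityI)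
    moreover have "?\<C> \<subseteq> powerset_basis" by (rule Collect_restrict)
    ultimately show ?case by (intro exI[of _ ?\<C>] conjI)
  next
    case (Basis s)
    then show ?case by (intro exI[of _ "{s}"]) auto
  qed
next
  assume "\<exists>\<B>. \<B> \<subseteq> powerset_basis \<and> W = \<Union>\<B>"
  then obtain \<B> where B: "\<B> \<subseteq> powerset_basis" "W = \<Union>\<B>" by (elim exE conjE)
  show "openin powerset_topology W"
    unfolding powerset_topology_def openin_topology_generated_by_iff B(2)
    by (rule generate_topology_on.UN, rule generate_topology_on.Basis) (use B(1) in auto)
qed

lemma topspace_powerset_topology [simp]: "topspace powerset_topology = UNIV"
proof -
  have "(UNIV :: 'a set set) \<in> powerset_basis"
    unfolding powerset_basis_def by (intro CollectI exI[of _ "{}"]) auto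
  then have "openin powerset_topology (UNIV :: 'a set set)"
    unfolding openin_powerset_topology by (intro exI[of _ "{UNIV}"]) auto
  then show ?thesis using openin_subset by blast
qed

definition nowhere_dense_in :: "'a topology \<Rightarrow> 'a set \<Rightarrow> bool"
  where "nowhere_dense_in X S \<longleftrightarrow>
    S \<subseteq> topspace X \<and> X interior_of (X closure_of S) = {}"

definition meagre_in :: "'a topology \<Rightarrow> 'a set \<Rightarrow> bool"
  where "meagre_in X S \<longleftrightarrow>
    (\<exists>\<N>. countable \<N> \<and> (\<forall>N\<in>\<N>. nowhere_dense_in X N) \<and> S = \<Union>\<N>)"

definition comeagre_in :: "'a topology \<Rightarrow> 'a set \<Rightarrow> bool"
  where "comeagre_in X S \<longleftrightarrow> S \<subseteq> topspace X \<and> meagre_in X (topspace X - S)"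

end

theory Submission
  imports Defs
begin

text \<open>
  A set of the form \<open>P -` B\<close> cannot separate two points with the same value under \<open>P\<close>.
  Unless \<open>P\<close> has degree \<open>1\<close>, there are such pairs of distinct points outside every finite set
  (\<open>non_linear_poly_collision\<close>).  A basic open set restricts membership of finitely many points
  only, so it can be refined by a condition that separates such a pair; hence the family of
  all sets \<open>P -` B\<close>, for a fixed such \<open>P\<close>, is nowhere dense (\<open>nowhere_dense_vimages\<close>).

  If \<open>P\<close> has degree \<open>1\<close>, it has a polynomial inverse, and \<open>A = P -` B\<close> gives \<open>B \<le>\<^sub>p A\<close>.  A set
  that is not maximal is therefore the preimage of some set under a polynomial whose degree is
  not \<open>1\<close>.  As there are only countably many polynomials over a countable field, the sets that
  are not maximal form a meagre family.
\<close>

text \<open>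
  An open set that misses \<open>S\<close> misses the closure of \<open>S\<close> too, so under the assumption no
  nonempty basic open set lies inside that closure.  In this form, proving nowhere density
  needs no description of the closure.
\<close>

lemma nowhere_dense_in_powerset_topologyI:
  assumes refine: "\<And>b. \<lbrakk>b \<in> powerset_basis; b \<noteq> {}\<rbrakk> \<Longrightarrow>
    \<exists>c. openin powerset_topology c \<and> c \<noteq> {} \<and> c \<subseteq> b \<and> c \<inter> S = {}"
  shows "nowhere_dense_in powerset_topology S"
proof -
  let ?X = powerset_topology
  define W where "W = ?X interior_of (?X closure_of S)"
  have W_closure: "W \<subseteq> ?X closure_of S"
    unfolding W_def by (rule interior_of_subset)
  have "openin ?X W"
    unfolding W_def by (rule openin_interior_of)
  then obtain \<B> where \<B>: "\<B> \<subseteq> powerset_basis" "W = \<Union>\<B>"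
    unfolding openin_powerset_topology by (elim exE conjE)
  have "b = {}" if "b \<in> \<B>" for b
  proof (rule ccontr)
    assume "b \<noteq> {}"
    moreover have "b \<in> powerset_basis" using that \<B>(1) by (rule rev_subsetD)
    ultimately obtain c where c: "openin ?X c" "c \<noteq> {}" "c \<subseteq> b" "c \<inter> S = {}"
      using refine by metis
    have "c \<inter> ?X closure_of S = {}"
      using c(1,4) by (simp add: openin_Int_closure_of_eq_empty)
    moreover have "c \<subseteq> ?X closure_of S"
      using c(3) that \<B>(2) W_closure by auto
    ultimately show False using c(2) by auto
  qed
  then have "W = {}" unfolding \<B>(2) by auto
  then show ?thesis unfolding nowhere_dense_in_def W_def by simp
qed

lemma nowhere_dense_in_subset:
  assumes "nowhere_dense_in X S" and "T \<subseteq> S"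
  shows "nowhere_dense_in X T"
proof -
  have "X interior_of (X closure_of T) \<subseteq> X interior_of (X closure_of S)"
    by (intro interior_of_mono closure_of_mono assms(2))
  then show ?thesis using assms unfolding nowhere_dense_in_def by blast
qed

text \<open>
  Take \<open>x\<close> with \<open>P' x \<noteq> 0\<close> and write \<open>P - P x = (X - x) Q\<close>.  If \<open>P\<close> has degree at least \<open>2\<close>, then
  \<open>Q\<close> has a root \<open>y\<close>; it differs from \<open>x\<close> because \<open>Q x = P' x\<close>.  Choosing \<open>P x\<close> outside the
  finite set \<open>P ` F\<close> keeps both points away from \<open>F\<close>.  Constant polynomials satisfy the claim
  because the field is infinite.
\<close>

lemma non_linear_poly_collision:
  fixes P :: "'k::{alg_closed_field, field_char_0} poly"
  assumes deg: "degree P \<noteq> 1" and F: "finite F"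
  obtains x y where "x \<notin> F" "y \<notin> F" "x \<noteq> y" "poly P x = poly P y"
proof (cases "degree P = 0")
  case True
  then obtain c where P: "P = [:c:]" by (rule degree_eq_zeroE)
  obtain x where x: "x \<notin> F"
    using ex_new_if_finite[OF infinite_UNIV_char_0 F] by blast
  obtain y where y: "y \<notin> insert x F"
    using ex_new_if_finite[OF infinite_UNIV_char_0, of "insert x F"] F by blast
  show thesis using that[of x y] x y P by auto
next
  case False
  have "finite {x. poly P x = c}" for c
  proof -
    have "P - [:c:] \<noteq> 0" using False by auto
    then have "finite {x. poly (P - [:c:]) x = 0}" by (rule poly_roots_finite)
    then show ?thesis by simp
  qed
  then have "finite (\<Union>z\<in>F. {x. poly P x = poly P z})" using F by blast
  moreover have "finite {x. poly (pderiv P) x = 0}"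
    using False by (intro poly_roots_finite) (simp add: pderiv_eq_0_iff)
  ultimately have "finite ((\<Union>z\<in>F. {x. poly P x = poly P z}) \<union> {x. poly (pderiv P) x = 0})"
    by blast
  from ex_new_if_finite[OF infinite_UNIV_char_0 this]
  obtain x where x: "\<And>z. z \<in> F \<Longrightarrow> poly P x \<noteq> poly P z" "poly (pderiv P) x \<noteq> 0"
    by blast
  define Q where "Q = synthetic_div P x"
  have P: "P = [:- x, 1:] * Q + [:poly P x:]"
    unfolding Q_def using synthetic_div_correct'[of x P] by simp
  have Qx: "poly Q x = poly (pderiv P) x"
    using arg_cong[OF P, of "\<lambda>R. poly (pderiv R) x"]
    by (simp add: pderiv_add pderiv_mult pderiv_pCons del: mult_pCons_left)
  have "degree Q > 0"
    unfolding Q_def degree_synthetic_div using deg False by simp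
  then obtain y where y: "poly Q y = 0"
    using alg_closed_imp_poly_has_root by blast
  have "poly P y = poly P x" using arg_cong[OF P, of "\<lambda>R. poly R y"] by (simp add: y)
  moreover have "y \<noteq> x" using y Qx x(2) by auto
  ultimately show thesis using that[of x y] x(1) by metis
qed

text \<open>
  The finite sets \<open>U\<close> and \<open>V\<close> of prescribed members and non-members leave some pair with
  \<open>P x = P y\<close> unconstrained.  Prescribing \<open>x\<close> as a member and \<open>y\<close> as a non-member is
  compatible with them and excludes every preimage under \<open>P\<close>.
\<close>

lemma nowhere_dense_vimages:
  fixes P :: "'k::{alg_closed_field, field_char_0} poly"
  assumes deg: "degree P \<noteq> 1"
  shows "nowhere_dense_in powerset_topology (range (vimage (poly P)))"
proof (rule nowhere_dense_in_powerset_topologyI)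
  fix b :: "'k set set"
  assume "b \<in> powerset_basis"
  then obtain U V where UV: "finite U" "finite V" "U \<inter> V = {}"
    and b: "b = {A. U \<subseteq> A \<and> V \<inter> A = {}}"
    unfolding powerset_basis_def by (elim CollectE exE conjE)
  obtain x y where xy: "x \<notin> U \<union> V" "y \<notin> U \<union> V" "x \<noteq> y" "poly P x = poly P y"
    using non_linear_poly_collision[OF deg, of "U \<union> V"] UV(1,2) by (metis finite_UnI)
  let ?c = "{A. insert x U \<subseteq> A \<and> insert y V \<inter> A = {}}"
  have "finite (insert x U)" "finite (insert y V)" "insert x U \<inter> insert y V = {}"
    using UV xy by auto
  then have "?c \<in> powerset_basis"
    unfolding powerset_basis_def
    by (intro CollectI exI[of _ "insert x U"] exI[of _ "insert y V"]) simp
  then have "openin powerset_topology ?c"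
    unfolding openin_powerset_topology by (intro exI[of _ "{?c}"]) simp
  moreover have "insert x U \<in> ?c"
    using \<open>insert x U \<inter> insert y V = {}\<close> by (simp add: Int_commute subset_insertI)
  then have "?c \<noteq> {}" by (rule ex_in_conv[THEN iffD1, OF exI])
  moreover have "?c \<subseteq> b" unfolding b by (rule Collect_mono) simp
  moreover have "A \<notin> range (vimage (poly P))" if "A \<in> ?c" for A
  proof
    assume "A \<in> range (vimage (poly P))"
    then obtain B where "A = poly P -` B" by (rule imageE)
    then have "x \<in> A \<longleftrightarrow> y \<in> A" using xy(4) by simp
    with that show False by auto
  qed
  then have "?c \<inter> range (vimage (poly P)) = {}" unfolding disjoint_iff by simp
  ultimately show "\<exists>c. openin powerset_topology c \<and> c \<noteq> {} \<and> c \<subseteq> b \<and>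
      c \<inter> range (vimage (poly P)) = {}"
    by (intro exI[of _ ?c] conjI)
qed

lemma poly_reducible_vimage_linear:
  fixes P :: "'k::field poly"
  assumes "degree P = 1"
  shows "B \<le>\<^sub>p poly P -` B"
proof -
  obtain a b where P: "P = [:b, a:]" and a: "a \<noteq> 0"
    using assms by (rule degree1_coeffs)
  have "poly P (poly [:- b / a, 1 / a:] z) = z" for z
    using a by (simp add: P left_diff_distrib)
  then have "B = poly [:- b / a, 1 / a:] -` (poly P -` B)"
    by (simp add: vimage_def)
  then show ?thesis unfolding poly_reducible_def by blast
qed

lemma countable_polys:
  assumes "countable (UNIV :: 'k::zero set)"
  shows "countable (UNIV :: 'k poly set)"
proof -
  have "countable (range (Poly :: 'k list \<Rightarrow> 'k poly))"
    using countable_lists[OF assms] by simp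
  moreover have "range Poly = (UNIV :: 'k poly set)"
    by (rule surjI) (rule Poly_coeffs)
  ultimately show ?thesis by simp
qed

theorem theorem49:
  assumes "countable (UNIV :: 'k::{alg_closed_field, field_char_0} set)"
  shows "comeagre_in powerset_topology {A :: 'k set. poly_maximal A}"
proof -
  let ?S = "{A :: 'k set. \<not> poly_maximal A}"
  \<comment> \<open>A meagre set has to equal the union of its nowhere dense pieces, not merely to be covered
    by them; hence the intersection with \<open>?S\<close>.\<close>
  let ?\<N> = "(\<lambda>P. range (vimage (poly P)) \<inter> ?S) ` {P :: 'k poly. degree P \<noteq> 1}"
  have "countable ?\<N>"
    by (intro countable_image countable_subset[OF subset_UNIV countable_polys[OF assms]])
  moreover have "\<forall>N\<in>?\<N>. nowhere_dense_in powerset_topology N"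
    by (auto intro: nowhere_dense_in_subset[OF nowhere_dense_vimages])
  moreover have "?S = \<Union>?\<N>"
  proof
    show "?S \<subseteq> \<Union>?\<N>"
    proof
      fix A assume A: "A \<in> ?S"
      then obtain B P where AP: "A = poly P -` B" and B: "\<not> B \<le>\<^sub>p A"
        unfolding poly_maximal_def poly_reducible_def by blast
      then have "degree P \<noteq> 1" using poly_reducible_vimage_linear by blast
      then show "A \<in> \<Union>?\<N>" using A AP by blast
    qed
  qed auto
  ultimately have "meagre_in powerset_topology ?S"
    unfolding meagre_in_def by (intro exI[of _ ?\<N>] conjI)
  moreover have "topspace powerset_topology - {A :: 'k set. poly_maximal A} = ?S" by auto
  ultimately show ?thesis unfolding comeagre_in_def by simp
qed

end
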